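(* Let $\mathbf{k}=(k_1,\dots,k_t),\mathbf{n}=(n_1,\dots,n_t)\in\mathbb{N}^t$ with $k=\sum_i k_i$, $n=\sum_i n_i$ and $k_i<n_i$ for all $i\in[t]$. Let $U$ be an $\mathbb{F}_q$-subspace of $\mathbb{V}(k,q^m)$ which is decomposable of type $(\mathbf{k},\mathbf{n})$, with components $U_1,\dots,U_t$ and $F_i=\langle U_i\rangle_{\mathbb{F}_{q^m}}$. Then $U$ is $\mathbf{k}$-scattered with respect to the hyperplanes if and only if the only $\mathbb{F}_{q^m}$-subspaces $T$ of $\mathbb{V}(k,q^m)$ which have positive defect $\varepsilon_U(T)>0$ and are minimal with respect to their defect are the subspaces of the form $\sum_{i\in I}F_i$ with $\emptyset\neq I\subseteq[t]$.
   Context: $q$ is a prime power, $m$ a positive integer, $\mathbb{V}(k,q^m)$ a $k$-dimensional $\mathbb{F}_{q^m}$-vector space (also regarded as an $\mathbb{F}_q$-space). For an $\mathbb{F}_q$-subspace $U$ and an $\mathbb{F}_{q^m}$-subspace $T$: $w_U(T)=\dim_{\mathbb{F}_q}(U\cap T)$ and $\varepsilon_U(T)=w_U(T)-\dim_{\mathbb{F}_{q^m}}(T)$. An $\mathbb{F}_{q^m}$-subspace $T$ is minimal with respect to its defect if every proper $\mathbb{F}_{q^m}$-subspace $T'$ of $T$ satisfies $\varepsilon_U(T')<\varepsilon_U(T)$. $U$ (of $\mathbb{F}_q$-dimension $n$) is decomposable of type $(\mathbf{k},\mathbf{n})$ if $U=U_1\oplus\dots\oplus U_t$ with $\dim_{\mathbb{F}_q}U_i=n_i$,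 and $\mathbb{V}(k,q^m)=F_1\oplus\dots\oplus F_t$ where $F_i=\langle U_i\rangle_{\mathbb{F}_{q^m}}$ has $\mathbb{F}_{q^m}$-dimension $k_i$ (the order of the components is immaterial). $U$ is $\mathbf{k}$-scattered with respect to the hyperplanes (of type $\mathbf{n}$) if: (1) $U$ is decomposable of type $(\mathbf{k},\mathbf{n})$; (2) $n_i>k_i$ and each $U_i$ is scattered with respect to the hyperplanes of $F_i$, i.e. $\dim_{\mathbb{F}_q}(U_i\cap H')\le k_i-1$ for every $\mathbb{F}_{q^m}$-hyperplane $H'$ of $F_i$; (3) $\dim_{\mathbb{F}_q}(U\cap H)\le k-1$ for every $\mathbb{F}_{q^m}$-hyperplane $H$ of $\mathbb{V}(k,q^m)$ containing none of $F_1,\dots,F_t$. *)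

theory Defs
  imports Complex_Main "HOL-Library.FuncSet" "HOL-Library.Cardinality"
begin

text \<open>
  The type \<open>'f\<close> plays the role of the field with \<open>q\<close> elements, \<open>'K\<close> that of the field with
  \<open>q ^ m\<close> elements, and \<open>emb\<close> is the inclusion of the former in the latter. The space over
  \<open>'K\<close> is given by its scalar multiplication \<open>scale\<close>; restriction of scalars along \<open>emb\<close>
  turns it into a space over \<open>'f\<close>.
\<close>

definition field_embedding :: "('f::field \<Rightarrow> 'K::field) \<Rightarrow> bool" where
  "field_embedding emb \<longleftrightarrow>
     emb 1 = 1 \<and> (\<forall>a b. emb (a + b) = emb a + emb b) \<and> (\<forall>a b. emb (a * b) = emb a * emb b)"

definition restrict_scale ::
  "('f::field \<Rightarrow> 'K::field) \<Rightarrow> ('K \<Rightarrow> 'v::ab_group_add \<Rightarrow> 'v) \<Rightarrow> 'f \<Rightarrow> 'v \<Rightarrow> 'v" where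
  "restrict_scale emb scale a v = scale (emb a) v"

definition weight ::
  "('f::field \<Rightarrow> 'K::field) \<Rightarrow> ('K \<Rightarrow> 'v::ab_group_add \<Rightarrow> 'v) \<Rightarrow> 'v set \<Rightarrow> 'v set \<Rightarrow> nat" where
  "weight emb scale U T = vector_space.dim (restrict_scale emb scale) (U \<inter> T)"

definition defect ::
  "('f::field \<Rightarrow> 'K::field) \<Rightarrow> ('K \<Rightarrow> 'v::ab_group_add \<Rightarrow> 'v) \<Rightarrow> 'v set \<Rightarrow> 'v set \<Rightarrow> int" where
  "defect emb scale U T = int (weight emb scale U T) - int (vector_space.dim scale T)"

definition minimal_wrt_defect ::
  "('f::field \<Rightarrow> 'K::field) \<Rightarrow> ('K \<Rightarrow> 'v::ab_group_add \<Rightarrow> 'v) \<Rightarrow> 'v set \<Rightarrow> 'v set \<Rightarrow> bool" where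
  "minimal_wrt_defect emb scale U T \<longleftrightarrow>
     (\<forall>T'. module.subspace scale T' \<and> T' \<subset> T \<longrightarrow> defect emb scale U T' < defect emb scale U T)"

definition sum_of_subspaces :: "'i set \<Rightarrow> ('i \<Rightarrow> 'v::ab_group_add set) \<Rightarrow> 'v set" where
  "sum_of_subspaces I A = (\<lambda>v. \<Sum>i\<in>I. v i) ` (\<Pi>\<^sub>E i\<in>I. A i)"

definition is_direct_sum :: "'i set \<Rightarrow> ('i \<Rightarrow> 'v::ab_group_add set) \<Rightarrow> 'v set \<Rightarrow> bool" where
  "is_direct_sum I A S \<longleftrightarrow>
     S = sum_of_subspaces I A \<and> inj_on (\<lambda>v. \<Sum>i\<in>I. v i) (\<Pi>\<^sub>E i\<in>I. A i)"

definition hyperplane_of ::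
  "('K::field \<Rightarrow> 'v::ab_group_add \<Rightarrow> 'v) \<Rightarrow> 'v set \<Rightarrow> 'v set \<Rightarrow> bool" where
  "hyperplane_of scale F H \<longleftrightarrow>
     module.subspace scale H \<and> H \<subseteq> F \<and> vector_space.dim scale H + 1 = vector_space.dim scale F"

text \<open>
  \<open>decomposition emb scale t ks ns U Us\<close>: the subspaces \<open>Us 1, \<dots>, Us t\<close> are components of a
  decomposition of \<open>U\<close> of type \<open>(ks, ns)\<close>. Only the values at \<open>1, \<dots>, t\<close> matter.
\<close>

definition decomposition ::
  "('f::field \<Rightarrow> 'K::field) \<Rightarrow> ('K \<Rightarrow> 'v::ab_group_add \<Rightarrow> 'v) \<Rightarrow> nat \<Rightarrow> (nat \<Rightarrow> nat) \<Rightarrow> (nat \<Rightarrow> nat) \<Rightarrow>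
     'v set \<Rightarrow> (nat \<Rightarrow> 'v set) \<Rightarrow> bool" where
  "decomposition emb scale t ks ns U Us \<longleftrightarrow>
     (\<forall>i\<in>{1..t}. module.subspace (restrict_scale emb scale) (Us i)) \<and>
     is_direct_sum {1..t} Us U \<and>
     (\<forall>i\<in>{1..t}. vector_space.dim (restrict_scale emb scale) (Us i) = ns i) \<and>
     is_direct_sum {1..t} (\<lambda>i. module.span scale (Us i)) UNIV \<and>
     (\<forall>i\<in>{1..t}. vector_space.dim scale (module.span scale (Us i)) = ks i)"

definition scattered_wrt_hyperplanes ::
  "('f::field \<Rightarrow> 'K::field) \<Rightarrow> ('K \<Rightarrow> 'v::ab_group_add \<Rightarrow> 'v) \<Rightarrow> 'v set \<Rightarrow> 'v set \<Rightarrow> bool" where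
  "scattered_wrt_hyperplanes emb scale F W \<longleftrightarrow>
     (\<forall>H. hyperplane_of scale F H \<longrightarrow>
        vector_space.dim (restrict_scale emb scale) (W \<inter> H) \<le> vector_space.dim scale F - 1)"

text \<open>
  Being scattered of type \<open>(ks, ns)\<close> is a property of \<open>U\<close> alone, so the components are
  existentially quantified. In the bounds \<open>\<dots> - 1\<close> the natural-number subtraction is exact, as
  a space having a hyperplane is of positive dimension.
\<close>

definition k_scattered ::
  "('f::field \<Rightarrow> 'K::field) \<Rightarrow> ('K \<Rightarrow> 'v::ab_group_add \<Rightarrow> 'v) \<Rightarrow> nat \<Rightarrow> (nat \<Rightarrow> nat) \<Rightarrow> (nat \<Rightarrow> nat) \<Rightarrow>
     'v set \<Rightarrow> bool" where
  "k_scattered emb scale t ks ns U \<longleftrightarrow>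
     (\<exists>Us. decomposition emb scale t ks ns U Us \<and>
        (\<forall>i\<in>{1..t}. ks i < ns i \<and>
           scattered_wrt_hyperplanes emb scale (module.span scale (Us i)) (Us i)) \<and>
        (\<forall>H. hyperplane_of scale UNIV H \<and> (\<forall>i\<in>{1..t}. \<not> module.span scale (Us i) \<subseteq> H) \<longrightarrow>
           vector_space.dim (restrict_scale emb scale) (U \<inter> H)
             \<le> vector_space.dim scale (UNIV :: 'v set) - 1))"

end

theory Submission
  imports Defs
begin

text \<open>
  Write \<open>F\<^sub>I\<close> for the sum of the \<open>F\<^sub>i\<close> with \<open>i \<in> I\<close>. If \<open>I\<close> is the set of all \<open>i\<close> with \<open>F\<^sub>i \<subseteq> T\<close>, then
  \<open>T\<close> and \<open>U \<inter> T\<close> split along \<open>F\<^sub>I\<close> and its complementary sum, and \<open>F\<^sub>I\<close> has defect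
  \<open>\<Sum>i\<in>I. n\<^sub>i - k\<^sub>i\<close>. So the forward direction reduces to showing that a subspace \<open>T\<close> containing no
  \<open>F\<^sub>i\<close> has nonpositive defect. This goes by induction on the codimension of \<open>T\<close>, hyperplanes being
  the hypothesis. If adjoining some \<open>u \<in> U - T\<close> to \<open>T\<close> produces no \<open>F\<^sub>i\<close>, the weight grows by at least
  one and induction applies. Otherwise \<open>U\<close> is covered by at most \<open>t\<close> spaces \<open>T + F\<^sub>i\<close>, each of dimension
  one more than \<open>T\<close>; these meet pairwise in \<open>T\<close>, which forces \<open>|U| \<le> t\<^sup>2 |U \<inter> T|\<close>. On the other hand a
  hyperplane containing no \<open>F\<^sub>i\<close> shows \<open>t < q\<^sup>m\<close>, so some vector avoids all these spaces, and induction
  applied to \<open>T\<close> extended by it bounds the weight of \<open>T\<close> by \<open>k - 1\<close>, hence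
  \<open>|U| \<ge> q\<^bsup>t + 1\<^esup> |U \<inter> T| > t\<^sup>2 |U \<inter> T|\<close>, a contradiction.

  Scatteredness allows a decomposition other than the given one. But each \<open>F\<^sub>i\<close> has positive defect,
  hence contains a minimal subspace and therefore one of the components of the other decomposition;
  comparing dimensions, the two families of spans agree up to order.
\<close>

section \<open>Cardinalities of spans and subspaces over a finite field\<close>

lemma card_span_independent:
  fixes scale :: "'a::{field,finite} \<Rightarrow> 'b::ab_group_add \<Rightarrow> 'b"
  assumes "vector_space scale" and "finite b" and "\<not> module.dependent scale b"
  shows "finite (module.span scale b) \<and> card (module.span scale b) = CARD('a) ^ card b"
proof -
  interpret vector_space scale by fact
  from assms(2,3) show ?thesis
  proof (induction b rule: finite_induct)
    case empty
    then show ?case by simp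
  next
    case (insert a b)
    let ?f = "\<lambda>(c, y). scale c a + y"
    have ind: "independent b" and a: "a \<notin> span b"
      using insert.prems insert.hyps by (auto simp: independent_insert)
    have "y \<in> ?f ` (UNIV \<times> span b)" if y: "y \<in> span (insert a b)" for y
    proof -
      obtain c where "y - scale c a \<in> span b" using y unfolding span_insert by blast
      then show ?thesis by (intro image_eqI[of _ _ "(c, y - scale c a)"]) auto
    qed
    moreover have "?f (c, y) \<in> span (insert a b)" if "y \<in> span b" for c y
      using that by (auto simp: span_insert intro!: exI[of _ c])
    ultimately have eq: "span (insert a b) = ?f ` (UNIV \<times> span b)" by auto
    have "inj_on ?f (UNIV \<times> span b)"
    proof (rule inj_onI, clarify)
      fix c y d z
      assume *: "y \<in> span b" "z \<in> span b" "scale c a + y = scale d a + z"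
      then have "scale (c - d) a = z - y" by (simp add: algebra_simps)
      then have "scale (c - d) a \<in> span b" using * by (simp add: span_diff)
      then have "c = d" using a span_scale[of "scale (c - d) a" b "inverse (c - d)"]
        by (cases "c = d") auto
      then show "c = d \<and> y = z" using * by simp
    qed
    then show ?case
      using insert.IH[OF ind] insert.hyps by (simp add: eq card_image card_cartesian_product)
  qed
qed

lemma card_subspace:
  fixes scale :: "'a::{field,finite} \<Rightarrow> 'b::ab_group_add \<Rightarrow> 'b"
  assumes "finite_dimensional_vector_space scale B" and "module.subspace scale S"
  shows "card S = CARD('a) ^ vector_space.dim scale S"
proof -
  interpret finite_dimensional_vector_space scale B by fact
  obtain b where b: "b \<subseteq> S" "independent b" "S \<subseteq> span b" "card b = dim S"
    using basis_exists by blast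
  then have "span b = S" using assms(2) by (simp add: span_minimal subset_antisym)
  then show ?thesis
    using card_span_independent[OF vector_space_axioms _ b(2)] b(4) finiteI_independent[OF b(2)]
    by auto
qed

text \<open>Used as n^2 < 2^(n+1). With the summand 2 the induction step comes down to 2n \<le> n^2
  + 1; with 1 in its place it would need 2n \<le> n^2, which fails at n = 1.\<close>

lemma square_add_2_le_power: "n\<^sup>2 + 2 \<le> (2::nat) ^ (n + 1)"
proof (induction n)
  case (Suc n)
  have "2 * int n \<le> (int n)\<^sup>2 + 1" using zero_le_power2[of "int n - 1"] by (simp add: power2_diff)
  then have "2 * n \<le> n\<^sup>2 + 1" by (simp flip: of_nat_power of_nat_Suc)
  then show ?case using Suc by (simp add: power2_eq_square)
qed simp

section \<open>Sums of families of subspaces\<close>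

lemma mem_sum_of_subspaces:
  "x \<in> sum_of_subspaces I A \<longleftrightarrow> (\<exists>v. (\<forall>i\<in>I. v i \<in> A i) \<and> x = (\<Sum>i\<in>I. v i))"
proof
  assume "\<exists>v. (\<forall>i\<in>I. v i \<in> A i) \<and> x = (\<Sum>i\<in>I. v i)"
  then obtain v where "\<forall>i\<in>I. v i \<in> A i" "x = (\<Sum>i\<in>I. v i)" by blast
  then show "x \<in> sum_of_subspaces I A"
    unfolding sum_of_subspaces_def by (intro image_eqI[of _ _ "restrict v I"]) auto
qed (auto simp: sum_of_subspaces_def PiE_iff)

lemma sum_of_subspaces_cong:
  "(\<And>i. i \<in> I \<Longrightarrow> A i = B i) \<Longrightarrow> sum_of_subspaces I A = sum_of_subspaces I B"
  by (auto simp: set_eq_iff mem_sum_of_subspaces)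

lemma sum_of_subspaces_singleton: "sum_of_subspaces {i} A = A i"
  by (auto simp: set_eq_iff mem_sum_of_subspaces intro!: exI[of _ "\<lambda>_. _"])

lemma sum_of_subspaces_reindex:
  assumes "inj_on f I"
  shows "sum_of_subspaces (f ` I) A = sum_of_subspaces I (\<lambda>i. A (f i))"
proof -
  have "\<exists>w. (\<forall>j\<in>f ` I. w j \<in> A j) \<and> sum v I = sum w (f ` I)" if "\<forall>i\<in>I. v i \<in> A (f i)" for v
    using that assms
    by (intro exI[of _ "\<lambda>j. v (the_inv_into I f j)"]) (auto simp: sum.reindex the_inv_into_f_f)
  then show ?thesis
    using assms by (fastforce simp: set_eq_iff mem_sum_of_subspaces sum.reindex)
qed

lemma direct_sum_unique:
  assumes "is_direct_sum N A S" and "\<And>i. i \<in> N \<Longrightarrow> v i \<in> A i" and "\<And>i. i \<in> N \<Longrightarrow> w i \<in> A i"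
    and "sum v N = sum w N" and "i \<in> N"
  shows "v i = w i"
proof -
  \<comment> \<open>Injectivity is assumed on extensional functions only, hence the
    restrictions.\<close>
  have "restrict v N = restrict w N"
    using assms(1) unfolding is_direct_sum_def
    by (elim conjE inj_onD) (use assms(2-4) in auto)
  then show ?thesis using assms(5) by (metis restrict_apply')
qed

context module
begin

lemma subspace_sum_of_subspaces:
  assumes "\<And>i. i \<in> I \<Longrightarrow> subspace (A i)"
  shows "subspace (sum_of_subspaces I A)"
proof (rule subspaceI)
  show "0 \<in> sum_of_subspaces I A"
    using assms by (auto simp: mem_sum_of_subspaces subspace_0 intro!: exI[of _ "\<lambda>_. 0"])
  show "x + y \<in> sum_of_subspaces I A"
    if xy: "x \<in> sum_of_subspaces I A" "y \<in> sum_of_subspaces I A" for x y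
  proof -
    from xy obtain v w where "\<forall>i\<in>I. v i \<in> A i" "x = sum v I" "\<forall>i\<in>I. w i \<in> A i" "y = sum w I"
      by (auto simp: mem_sum_of_subspaces)
    then show ?thesis unfolding mem_sum_of_subspaces
      using assms by (intro exI[of _ "\<lambda>i. v i + w i"]) (auto simp: sum.distrib subspace_add)
  qed
  show "c *s x \<in> sum_of_subspaces I A" if x: "x \<in> sum_of_subspaces I A" for c x
  proof -
    from x obtain v where "\<forall>i\<in>I. v i \<in> A i" "x = sum v I"
      by (auto simp: mem_sum_of_subspaces)
    then show ?thesis unfolding mem_sum_of_subspaces
      using assms by (intro exI[of _ "\<lambda>i. c *s v i"]) (auto simp: scale_sum_right subspace_scale)
  qed
qed

lemma sum_of_subspaces_least:
  assumes "subspace S" and "\<And>i. i \<in> I \<Longrightarrow> A i \<subseteq> S"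
  shows "sum_of_subspaces I A \<subseteq> S"
  using assms by (force simp: mem_sum_of_subspaces intro!: subspace_sum)

end

section \<open>Restriction of scalars, weights and defects\<close>

locale scalar_restriction = V: finite_dimensional_vector_space scale Basis
  for scale :: "'K::{field,finite} \<Rightarrow> 'v::ab_group_add \<Rightarrow> 'v" and Basis :: "'v set" +
  fixes emb :: "'f::{field,finite} \<Rightarrow> 'K"
  assumes emb: "field_embedding emb"
begin

sublocale R: vector_space "restrict_scale emb scale"
  using emb by unfold_locales
    (auto simp: restrict_scale_def field_embedding_def V.scale_right_distrib V.scale_left_distrib)

lemma finite_UNIV_space: "finite (UNIV :: 'v set)"
  using card_span_independent[OF V.vector_space_axioms V.finite_Basis V.independent_Basis]
    V.span_Basis by simp

lemma finite_vectors [simp, intro]: "finite (S :: 'v set)"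
  by (rule finite_subset[OF subset_UNIV finite_UNIV_space])

text \<open>The whole space is finite, so the basis over \<open>'f\<close> obtained by extending the
  empty set is finite. This makes the dimension formulas available over \<open>'f\<close>
  too.\<close>

sublocale R: finite_dimensional_vector_space "restrict_scale emb scale" "R.extend_basis {}"
proof
  show "R.independent (R.extend_basis {})"
    by (rule R.independent_extend_basis) (rule R.independent_empty)
  show "R.span (R.extend_basis {}) = UNIV"
    by (rule R.span_extend_basis) (rule R.independent_empty)
qed simp

lemma subspace_restrict: "V.subspace S \<Longrightarrow> R.subspace S"
  by (auto simp: V.subspace_def R.subspace_def restrict_scale_def)

lemma card_V: "V.subspace S \<Longrightarrow> card S = CARD('K) ^ V.dim S"
  by (rule card_subspace) (rule V.finite_dimensional_vector_space_axioms)

lemma card_R: "R.subspace S \<Longrightarrow> card S = CARD('f) ^ R.dim S"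
  by (rule card_subspace) (rule R.finite_dimensional_vector_space_axioms)

lemma card_scalars_ge_2: "2 \<le> CARD('f)"
  by (rule order.trans[of _ "card {0, 1 :: 'f}"]) (simp, rule card_mono, auto)

text \<open>A subspace that is not minimal has a proper subspace of at least the same defect; by
  finiteness this descent ends.\<close>

lemma exists_minimal_wrt_defect:
  assumes "V.subspace T"
  shows "\<exists>M. V.subspace M \<and> M \<subseteq> T \<and> defect emb scale U T \<le> defect emb scale U M \<and>
    minimal_wrt_defect emb scale U M"
  using finite_vectors[of T] assms
proof (induction T rule: finite_psubset_induct)
  case (psubset T)
  show ?case
  proof (cases "minimal_wrt_defect emb scale U T")
    case True
    then show ?thesis using psubset.prems by blast
  next
    case False
    then obtain T' where T': "V.subspace T'" "T' \<subset> T" "defect emb scale U T \<le> defect emb scale U T'"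
      by (auto simp: minimal_wrt_defect_def not_less)
    show ?thesis using psubset.IH[OF T'(2,1)] T'(2,3) by force
  qed
qed

text \<open>Both dimensions are additive on direct sums. The last hypothesis is a genuine condition:
  in general \<open>U \<inter> T\<close> can be larger than the sum of \<open>U \<inter> A\<close>
  and \<open>U \<inter> C\<close>.\<close>

lemma defect_direct_sum:
  assumes "R.subspace U" "V.subspace A" "V.subspace C" "A \<inter> C = {0}"
    and T: "T = {a + c |a c. a \<in> A \<and> c \<in> C}"
    and UT: "\<And>x. x \<in> U \<inter> T \<Longrightarrow> \<exists>a\<in>U \<inter> A. \<exists>c\<in>U \<inter> C. x = a + c"
  shows "defect emb scale U T = defect emb scale U A + defect emb scale U C"
proof -
  have UT_eq: "U \<inter> T = {a + c |a c. a \<in> U \<inter> A \<and> c \<in> U \<inter> C}"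
  proof (intro equalityI subsetI)
    fix x assume "x \<in> U \<inter> T"
    then show "x \<in> {a + c |a c. a \<in> U \<inter> A \<and> c \<in> U \<inter> C}" using UT by blast
  qed (use assms(1) in \<open>auto simp: T intro: R.subspace_add\<close>)
  have sub: "R.subspace (U \<inter> A)" "R.subspace (U \<inter> C)"
    using assms by (auto intro: R.subspace_inter subspace_restrict)
  have zero: "(U \<inter> A) \<inter> (U \<inter> C) = {0}" using assms(1,4) R.subspace_0 by blast
  show ?thesis
    using V.dim_sums_Int[OF assms(2,3)] R.dim_sums_Int[OF sub] assms(4) zero
    by (simp add: defect_def weight_def UT_eq flip: T)
qed

text \<open>One factor \<open>card \<G>\<close> comes from covering \<open>U\<close> by its traces
  on the members of \<open>\<G>\<close>, the other from bounding each trace.\<close>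

lemma card_le_of_cover:
  assumes U: "R.subspace U" and fin: "finite \<G>" and sub: "\<And>G. G \<in> \<G> \<Longrightarrow> R.subspace G"
    and cover: "U \<subseteq> \<Union> \<G>" and proper: "\<And>G. G \<in> \<G> \<Longrightarrow> \<not> U \<subseteq> G"
    and int: "\<And>G G'. G \<in> \<G> \<Longrightarrow> G' \<in> \<G> \<Longrightarrow> G \<noteq> G' \<Longrightarrow> G \<inter> G' \<subseteq> T"
  shows "card U \<le> (card \<G>)\<^sup>2 * card (U \<inter> T)"
proof -
  have le: "card (U \<inter> G) \<le> card \<G> * card (U \<inter> T)" if G: "G \<in> \<G>" for G
  proof -
    obtain u where u: "u \<in> U" "u \<notin> G" using proper[OF G] by blast
    \<comment> \<open>A coset of \<open>U \<inter> G\<close> other than \<open>U \<inter> G\<close> avoids \<open>G\<close>, and each other member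
      of the cover meets it in a subset of a single coset of \<open>U \<inter> T\<close>.\<close>
    define C where "C = (+) u ` (U \<inter> G)"
    have C_U: "C \<subseteq> U" using U u by (auto simp: C_def intro: R.subspace_add)
    have diff_C: "x - y \<in> U \<inter> G" if "x \<in> C" "y \<in> C" for x y
      using that U sub[OF G] by (auto simp: C_def intro: R.subspace_diff)
    have C_G: "x \<notin> G" if "x \<in> C" for x
    proof
      assume "x \<in> G"
      moreover obtain y where "y \<in> G" "x = u + y" using \<open>x \<in> C\<close> by (auto simp: C_def)
      ultimately have "u \<in> G" using R.subspace_diff[OF sub[OF G], of x y] by simp
      then show False using u by simp
    qed
    have piece: "card (C \<inter> G') \<le> card (U \<inter> T)" if G': "G' \<in> \<G>" for G'
    proof (cases "C \<inter> G' = {}")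
      case False
      then obtain y where y: "y \<in> C" "y \<in> G'" by blast
      then have "G \<noteq> G'" using C_G by blast
      then have "x - y \<in> U \<inter> T" if "x \<in> C \<inter> G'" for x
        using diff_C[of x y] R.subspace_diff[OF sub[OF G'], of x y] y that int[OF G G'] by blast
      then show ?thesis
        by (intro card_inj_on_le[of "\<lambda>x. x - y"]) (auto simp: inj_on_def)
    qed simp
    have "card (U \<inter> G) = card C" by (simp add: C_def card_image)
    also have "\<dots> \<le> card (\<Union>G'\<in>\<G>. C \<inter> G')"
      using C_U cover by (intro card_mono) auto
    also have "\<dots> \<le> (\<Sum>G'\<in>\<G>. card (C \<inter> G'))" by (rule card_UN_le[OF fin])
    also have "\<dots> \<le> card \<G> * card (U \<inter> T)" 
      using sum_bounded_above[of \<G> "\<lambda>G'. card (C \<inter> G')", OF piece] by simp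
    finally show ?thesis .
  qed
  have "card U \<le> card (\<Union>G\<in>\<G>. U \<inter> G)" using cover by (intro card_mono) auto
  also have "\<dots> \<le> (\<Sum>G\<in>\<G>. card (U \<inter> G))" by (rule card_UN_le[OF fin])
  also have "\<dots> \<le> card \<G> * (card \<G> * card (U \<inter> T))"
    using sum_bounded_above[of \<G> "\<lambda>G. card (U \<inter> G)", OF le] by simp
  finally show ?thesis by (simp add: power2_eq_square mult.assoc)
qed

end

section \<open>Sums of components and their defects\<close>

locale decomposed_subspace = scalar_restriction scale Basis emb
  for scale :: "'K::{field,finite} \<Rightarrow> 'v::ab_group_add \<Rightarrow> 'v" and Basis :: "'v set"
    and emb :: "'f::{field,finite} \<Rightarrow> 'K" +
  fixes N :: "'i set" and Us :: "'i \<Rightarrow> 'v set" and U :: "'v set"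
  assumes finite_index: "finite N"
    and subspace_component: "i \<in> N \<Longrightarrow> R.subspace (Us i)"
    and direct_sum_U: "is_direct_sum N Us U"
    and direct_sum_V: "is_direct_sum N (\<lambda>i. V.span (Us i)) UNIV"
    and dim_component: "i \<in> N \<Longrightarrow> V.dim (V.span (Us i)) < R.dim (Us i)"
begin

abbreviation F :: "'i \<Rightarrow> 'v set" where "F i \<equiv> V.span (Us i)"

abbreviation FS :: "'i set \<Rightarrow> 'v set" where "FS I \<equiv> sum_of_subspaces I F"

abbreviation eps :: "'v set \<Rightarrow> int" where "eps \<equiv> defect emb scale U"

lemma subspace_U: "R.subspace U"
  using direct_sum_U subspace_component R.subspace_sum_of_subspaces
  by (auto simp: is_direct_sum_def)

lemma subspace_FS: "V.subspace (FS I)"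
  by (rule V.subspace_sum_of_subspaces) simp

text \<open>A representation over \<open>I\<close>, padded by zeros, is one over \<open>N\<close>,
  and representations over \<open>N\<close> are unique. Inclusions between the spaces
  \<open>FS I\<close> thereby become conditions on coordinates.\<close>

lemma mem_FS_iff:
  assumes "I \<subseteq> N" and v: "\<And>i. i \<in> N \<Longrightarrow> v i \<in> F i"
  shows "sum v N \<in> FS I \<longleftrightarrow> (\<forall>i\<in>N - I. v i = 0)"
proof
  assume "sum v N \<in> FS I"
  then obtain w where w: "\<forall>i\<in>I. w i \<in> F i" "sum v N = sum w I"
    by (auto simp: mem_sum_of_subspaces)
  define w' where "w' i = (if i \<in> I then w i else 0)" for i
  have eq: "sum v N = sum w' N"
    using w(2) assms(1) finite_index
    by (simp add: w'_def sum.If_cases Int_absorb1)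
  have "v i = w' i" if "i \<in> N" for i
    by (rule direct_sum_unique[OF direct_sum_V _ _ eq that])
      (use w(1) v in \<open>auto simp: w'_def V.span_zero\<close>)
  then show "\<forall>i\<in>N - I. v i = 0" by (auto simp: w'_def)
next
  assume "\<forall>i\<in>N - I. v i = 0"
  then have "sum v N = sum v I"
    using assms(1) finite_index by (intro sum.mono_neutral_right) auto
  then show "sum v N \<in> FS I" using assms by (auto simp: mem_sum_of_subspaces)
qed

lemma decompose_V:
  obtains v where "\<And>i. i \<in> N \<Longrightarrow> v i \<in> F i" and "x = sum v N"
proof -
  have "x \<in> FS N" using direct_sum_V by (auto simp: is_direct_sum_def)
  then show ?thesis using that by (auto simp: mem_sum_of_subspaces)
qed

lemma decompose_U:
  assumes "x \<in> U"
  obtains v where "\<And>i. i \<in> N \<Longrightarrow> v i \<in> Us i" and "x = sum v N"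
proof -
  have "x \<in> sum_of_subspaces N Us" using direct_sum_U assms by (auto simp: is_direct_sum_def)
  then show ?thesis using that by (auto simp: mem_sum_of_subspaces)
qed

lemma component_subset: "i \<in> N \<Longrightarrow> Us i \<subseteq> U"
proof
  fix x assume i: "i \<in> N" and "x \<in> Us i"
  then have "x \<in> sum_of_subspaces N Us"
    unfolding mem_sum_of_subspaces using finite_index subspace_component R.subspace_0
    by (intro exI[of _ "\<lambda>j. if j = i then x else 0"]) auto
  then show "x \<in> U" using direct_sum_U by (simp add: is_direct_sum_def)
qed

lemma span_U: "V.span U = UNIV"
proof -
  have "x \<in> V.span U" for x
  proof (rule decompose_V)
    fix v assume "\<And>i. i \<in> N \<Longrightarrow> v i \<in> F i" and x: "x = sum v N"
    then show "x \<in> V.span U"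
      unfolding x using V.span_mono[OF component_subset] by (intro V.span_sum) blast
  qed
  then show ?thesis by blast
qed

lemma FS_Int_complement: "I \<subseteq> N \<Longrightarrow> FS I \<inter> FS (N - I) = {0}"
proof -
  assume I: "I \<subseteq> N"
  have "x = 0" if x: "x \<in> FS I" "x \<in> FS (N - I)" for x
  proof (rule decompose_V[of x])
    fix v assume v: "\<And>i. i \<in> N \<Longrightarrow> v i \<in> F i" and "x = sum v N"
    then show "x = 0" using x I mem_FS_iff[OF _ v] by (auto intro!: sum.neutral)
  qed
  then show ?thesis using V.subspace_0[OF subspace_FS] by blast
qed

lemma split_V:
  assumes "I \<subseteq> N"
  shows "\<exists>y\<in>FS I. \<exists>z\<in>FS (N - I). x = y + z"
proof (rule decompose_V[of x])
  fix v assume v: "\<And>i. i \<in> N \<Longrightarrow> v i \<in> F i" and "x = sum v N"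
  then have "x = sum v I + sum v (N - I)"
    using assms finite_index by (metis add.commute sum.subset_diff)
  moreover have "sum v I \<in> FS I" "sum v (N - I) \<in> FS (N - I)"
    using v assms by (auto simp: mem_sum_of_subspaces)
  ultimately show ?thesis by blast
qed

text \<open>The coordinates of a vector of \<open>U\<close> lie in the \<open>Us i\<close>, hence in
  \<open>U\<close>, and so do their partial sums. This is the compatibility required by
  \<open>defect_direct_sum\<close>.\<close>

lemma split_U:
  assumes "I \<subseteq> N" and "x \<in> U"
  shows "\<exists>y\<in>U \<inter> FS I. \<exists>z\<in>U \<inter> FS (N - I). x = y + z"
proof (rule decompose_U[OF assms(2)])
  fix v assume v: "\<And>i. i \<in> N \<Longrightarrow> v i \<in> Us i" and "x = sum v N"
  then have "x = sum v I + sum v (N - I)"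
    using assms finite_index by (metis add.commute sum.subset_diff)
  moreover have "sum v I \<in> FS I" "sum v (N - I) \<in> FS (N - I)"
    using V.span_base[OF v] assms by (auto simp: mem_sum_of_subspaces)
  moreover have "sum v J \<in> U" if "J \<subseteq> N" for J
    using that v component_subset by (intro R.subspace_sum[OF subspace_U]) blast
  ultimately show ?thesis using assms(1) by blast
qed

lemma U_Int_F: "i \<in> N \<Longrightarrow> U \<inter> F i = Us i"
proof
  assume i: "i \<in> N"
  show "U \<inter> F i \<subseteq> Us i"
  proof
    fix x assume x: "x \<in> U \<inter> F i"
    then obtain v where v: "\<And>i. i \<in> N \<Longrightarrow> v i \<in> Us i" and xv: "x = sum v N"
      using decompose_U by (metis IntD1)
    have "x \<in> FS {i}" using x by (simp add: sum_of_subspaces_singleton)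
    then have "\<forall>j\<in>N - {i}. v j = 0"
      using mem_FS_iff[of "{i}" v] v V.span_base i xv by blast
    then have "x = v i" using xv i finite_index by (simp add: sum.remove)
    then show "x \<in> Us i" using v i by simp
  qed
qed (auto intro: V.span_base dest: component_subset)

text \<open>As \<open>T\<close> contains \<open>FS I\<close>, removing from a vector of
  \<open>T\<close> its part in \<open>FS I\<close> leaves a vector of \<open>T\<close>. So
  \<open>T\<close> and \<open>U \<inter> T\<close> split along \<open>FS I\<close> and
  \<open>FS (N - I)\<close>.\<close>

lemma defect_split:
  assumes "V.subspace T" and "I \<subseteq> N" and "FS I \<subseteq> T"
  shows "eps T = eps (FS I) + eps (T \<inter> FS (N - I))"
proof (rule defect_direct_sum)
  show "R.subspace U" "V.subspace (FS I)" "V.subspace (T \<inter> FS (N - I))"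
    using assms subspace_U subspace_FS by (auto intro: V.subspace_inter)
  show "FS I \<inter> (T \<inter> FS (N - I)) = {0}"
    using FS_Int_complement[OF assms(2)] V.subspace_0[OF assms(1)] by blast
  have in_T: "z \<in> T" if "y + z \<in> T" "y \<in> FS I" for y z
    using V.subspace_diff[OF assms(1) that(1), of y] that(2) assms(3) by auto
  show "T = {a + c |a c. a \<in> FS I \<and> c \<in> T \<inter> FS (N - I)}"
  proof (intro equalityI subsetI)
    fix x assume "x \<in> T"
    then show "x \<in> {a + c |a c. a \<in> FS I \<and> c \<in> T \<inter> FS (N - I)}"
      using split_V[OF assms(2), of x] in_T by blast
  qed (use assms(1,3) in \<open>auto intro: V.subspace_add\<close>)
  show "\<exists>a\<in>U \<inter> FS I. \<exists>c\<in>U \<inter> (T \<inter> FS (N - I)). x = a + c" if "x \<in> U \<inter> T" for x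
    using split_U[OF assms(2), of x] in_T that by blast
qed

lemma F_nonzero: "i \<in> N \<Longrightarrow> \<exists>x\<in>F i. x \<noteq> 0"
  using dim_component[of i] R.dim_eq_0[of "Us i"] V.span_base
  by (metis less_nat_zero_code singletonI subsetI)

lemma F_subset_FS: "i \<in> I \<Longrightarrow> I \<subseteq> N \<Longrightarrow> F i \<subseteq> FS I"
proof
  fix x assume i: "i \<in> I" "I \<subseteq> N" and "x \<in> F i"
  then show "x \<in> FS I"
    unfolding mem_sum_of_subspaces using finite_index finite_subset[OF i(2)]
    by (intro exI[of _ "\<lambda>j. if j = i then x else 0"]) (auto simp: V.span_zero)
qed

lemma F_subset_FS_D:
  assumes "i \<in> N" "I \<subseteq> N" "F i \<subseteq> FS I"
  shows "i \<in> I"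
proof (rule ccontr)
  assume "i \<notin> I"
  obtain x where x: "x \<in> F i" "x \<noteq> 0" using F_nonzero assms(1) by blast
  have "(\<Sum>j\<in>N. if j = i then x else 0) \<in> FS I"
    using assms finite_index x(1) by auto
  then show False
    using mem_FS_iff[OF assms(2), of "\<lambda>j. if j = i then x else 0"] x assms(1) \<open>i \<notin> I\<close>
    by (auto simp: V.span_zero split: if_splits)
qed

text \<open>Components are split off one at a time; the weight of \<open>F i\<close> is known from
  \<open>U_Int_F\<close>.\<close>

lemma defect_FS:
  assumes "I \<subseteq> N"
  shows "eps (FS I) = (\<Sum>i\<in>I. int (R.dim (Us i)) - int (V.dim (F i)))"
  using finite_subset[OF assms finite_index] assms
proof (induction I rule: finite_induct)
  case empty
  have "R.dim (U \<inter> {0}) = 0" by simp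
  then show ?case by (simp add: sum_of_subspaces_def defect_def weight_def)
next
  case (insert i I)
  have "FS (insert i I) \<inter> FS (N - {i}) = FS I"
  proof (rule set_eqI)
    fix x
    show "x \<in> FS (insert i I) \<inter> FS (N - {i}) \<longleftrightarrow> x \<in> FS I"
    proof (rule decompose_V[of x])
      fix v assume v: "\<And>i. i \<in> N \<Longrightarrow> v i \<in> F i" and "x = sum v N"
      then show ?thesis using insert mem_FS_iff[OF _ v] by auto
    qed
  qed
  moreover have "FS {i} \<subseteq> FS (insert i I)"
    using F_subset_FS[of i "insert i I"] insert.prems by (simp add: sum_of_subspaces_singleton)
  ultimately have "eps (FS (insert i I)) = eps (F i) + eps (FS I)"
    using defect_split[OF subspace_FS, of "{i}" "insert i I"] insert.prems
    by (simp add: sum_of_subspaces_singleton)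
  then show ?case
    using insert U_Int_F[of i] by (simp add: defect_def weight_def)
qed

lemma defect_FS_pos: "I \<subseteq> N \<Longrightarrow> I \<noteq> {} \<Longrightarrow> 0 < eps (FS I)"
  unfolding defect_FS
  by (rule sum_pos) (use dim_component finite_index finite_subset in auto)

text \<open>Every component contributes at least 1 to the defect of the whole space. This surplus is
  the source of the exponent \<open>card N + 1\<close> in both counting arguments below.\<close>

lemma dim_U_ge: "V.dim UNIV + card N \<le> R.dim U"
proof -
  have "(\<Sum>i\<in>N. 1) \<le> (\<Sum>i\<in>N. int (R.dim (Us i)) - int (V.dim (F i)))"
    by (rule sum_mono) (use dim_component in force)
  moreover have "FS N = UNIV" using direct_sum_V by (simp add: is_direct_sum_def)
  ultimately show ?thesis
    using defect_FS[of N] by (simp add: defect_def weight_def)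
qed

section \<open>Hyperplanes containing no component, and the number of components\<close>

lemma exists_hyperplane_avoiding:
  assumes "N \<noteq> {}"
  shows "\<exists>H. hyperplane_of scale UNIV H \<and> (\<forall>i\<in>N. \<not> F i \<subseteq> H)"
proof -
  \<comment> \<open>Nonzero vectors chosen from the different \<open>F i\<close> are independent, so
    some linear functional takes the value 1 at all of them. Its kernel is the required
    hyperplane.\<close>
  obtain f where f: "\<And>i. i \<in> N \<Longrightarrow> f i \<in> F i \<and> f i \<noteq> 0" using F_nonzero by metis
  have coeff: "c i = 0" if "(\<Sum>i\<in>N. scale (c i) (f i)) = 0" "i \<in> N" for c i
  proof -
    have "scale (c i) (f i) = 0"
      by (rule direct_sum_unique[OF direct_sum_V,
            where v = "\<lambda>i. scale (c i) (f i)" and w = "\<lambda>_. 0"])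
        (use f that in \<open>auto intro: V.span_scale V.span_zero\<close>)
    then show ?thesis using f that by simp
  qed
  have inj: "inj_on f N"
  proof (rule inj_onI, rule ccontr)
    fix i j assume ij: "i \<in> N" "j \<in> N" "f i = f j" "i \<noteq> j"
    have "(\<Sum>l\<in>N. if l = i then f i else 0) = (\<Sum>l\<in>N. if l = j then f j else 0)"
      using ij finite_index by simp
    from direct_sum_unique[OF direct_sum_V _ _ this ij(1)]
    have "(if i = i then f i else 0) = (if i = j then f j else 0)"
      using f ij(1,2) V.span_zero by presburger
    then show False using f ij by simp
  qed
  have ind: "V.independent (f ` N)"
    unfolding V.dependent_finite[OF finite_imageI[OF finite_index]]
    using coeff[of "\<lambda>i. u (f i)" for u] by (auto simp: sum.reindex[OF inj])
  interpret P: vector_space_pair scale "(*) :: 'K \<Rightarrow> 'K \<Rightarrow> 'K"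
    by unfold_locales (auto simp: algebra_simps)
  obtain g where g: "Vector_Spaces.linear scale (*) g" "\<forall>x\<in>f ` N. g x = (1::'K)"
    using P.linear_independent_extend[OF ind, of "\<lambda>_. 1"] by blast
  define H where "H = {x. g x = 0}"
  have H: "V.subspace H" unfolding H_def by (rule P.linear_subspace_kernel[OF g(1)])
  \<comment> \<open>One vector outside the kernel spans the whole space together with it, so the
    kernel has codimension 1.\<close>
  obtain i where i: "i \<in> N" using assms by blast
  have "x \<in> V.span (insert (f i) H)" for x
  proof -
    have "g (x - scale (g x) (f i)) = 0"
      using g i by (simp add: P.linear_diff P.linear_scale)
    then have "x - scale (g x) (f i) \<in> V.span H" by (simp add: H_def V.span_base)
    then show ?thesis unfolding V.span_insert by blast
  qed
  then have "V.dim UNIV = V.dim (insert (f i) H)"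
    by (metis UNIV_eq_I V.dim_span)
  moreover have "f i \<notin> V.span H"
    using g i by (simp add: V.span_eq_iff[THEN iffD2, OF H]) (simp add: H_def)
  ultimately have "V.dim H + 1 = V.dim UNIV" by (simp add: V.dim_insert)
  then show ?thesis
    using H f g by (intro exI[of _ H]) (auto simp: hyperplane_of_def H_def subset_iff, force)
qed

text \<open>Take a hyperplane \<open>H\<close> containing no \<open>F i\<close>. Scatteredness
  bounds the dimension of \<open>U \<inter> H\<close> from above, and the dimension formula over
  \<open>'f\<close> together with \<open>dim_U_ge\<close> bounds it from below. Comparing the bounds
  shows that \<open>H\<close> has codimension at least \<open>card N + 1\<close> over
  \<open>'f\<close>.\<close>

lemma card_index_less:
  assumes scattered: "\<And>H. hyperplane_of scale UNIV H \<Longrightarrow> \<forall>i\<in>N. \<not> F i \<subseteq> H \<Longrightarrow>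
      R.dim (U \<inter> H) \<le> V.dim UNIV - 1"
    and "N \<noteq> {}"
  shows "card N < CARD('K)"
proof -
  obtain H where H: "hyperplane_of scale UNIV H" "\<forall>i\<in>N. \<not> F i \<subseteq> H"
    using exists_hyperplane_avoiding[OF assms(2)] by blast
  then have sub: "V.subspace H" and dim_H: "V.dim UNIV = V.dim H + 1"
    by (auto simp: hyperplane_of_def)
  have "R.dim (U \<inter> H) \<le> V.dim H" using scattered[OF H] dim_H by simp
  moreover have "R.dim U + R.dim H \<le> R.dim UNIV + R.dim (U \<inter> H)"
    using R.dim_sums_Int[OF subspace_U subspace_restrict[OF sub]]
      R.dim_subset[of "{x + y |x y. x \<in> U \<and> y \<in> H}" UNIV] by simp
  ultimately have "card N + 1 + R.dim H \<le> R.dim UNIV" using dim_U_ge dim_H by simp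
  \<comment> \<open>The degree of \<open>'K\<close> over \<open>'f\<close> is not a parameter here.
    It is replaced by cardinalities: the space has \<open>CARD('K)\<close> times as many elements as
    \<open>H\<close>.\<close>
  then have "CARD('f) ^ (card N + 1 + R.dim H) \<le> CARD('f) ^ R.dim UNIV"
    by (rule power_increasing) simp
  then have "CARD('f) ^ (card N + 1) * card H \<le> CARD('v)"
    using card_R[OF subspace_restrict[OF sub]] card_R[of UNIV] by (simp add: power_add)
  also have "\<dots> = CARD('K) * card H"
    using card_V[OF sub] card_V[of UNIV] dim_H by simp
  finally have "CARD('f) ^ (card N + 1) \<le> CARD('K)"
    using V.subspace_0[OF sub] by (auto simp: card_gt_0_iff)
  moreover have "card N < 2 ^ card N" by (rule less_exp)
  moreover have "(2::nat) ^ card N \<le> CARD('f) ^ card N"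
    by (rule power_mono) (use card_scalars_ge_2 in auto)
  moreover have "CARD('f) ^ card N \<le> CARD('f) ^ (card N + 1)"
    by (rule power_increasing) auto
  ultimately show ?thesis by linarith
qed

section \<open>Subspaces containing no component have nonpositive defect\<close>

lemma defect_nonpos:
  assumes scattered: "\<And>H. hyperplane_of scale UNIV H \<Longrightarrow> \<forall>i\<in>N. \<not> F i \<subseteq> H \<Longrightarrow>
      R.dim (U \<inter> H) \<le> V.dim UNIV - 1"
    and "V.subspace T" and "\<forall>i\<in>N. \<not> F i \<subseteq> T"
  shows "eps T \<le> 0"
proof (cases "N = {}")
  case True
  then have "(UNIV :: 'v set) = {0}"
    using direct_sum_V by (simp add: is_direct_sum_def sum_of_subspaces_def)
  then have "U \<inter> T \<subseteq> {0}" by blast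
  then have "R.dim (U \<inter> T) = 0" by (simp only: R.dim_eq_0)
  then have "R.dim (U \<inter> T) \<le> V.dim T" by linarith
  then show ?thesis by (simp add: defect_def weight_def)
next
  case False
  note card_N = card_index_less[OF scattered False]
  have "R.dim (U \<inter> T) \<le> V.dim T"
    using assms(2,3)
  proof (induction "V.dim UNIV - V.dim T" arbitrary: T rule: less_induct)
    case less
    note T = less.prems(1)
    have span_T: "V.span T = T" using T by simp
    have subspace_UT: "R.subspace (U \<inter> T)"
      by (rule R.subspace_inter[OF subspace_U subspace_restrict[OF T]])
    have "T \<noteq> UNIV" using False less.prems(2) by auto
    then have dim_less: "V.dim T < V.dim UNIV"
      using T by (metis V.dim_subset V.subspace_UNIV V.subspace_dim_equal not_less subset_UNIV)
    \<comment> \<open>By \<open>G_ext\<close>, \<open>A\<close> contains every index whose component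
      can be produced by adjoining a single vector to \<open>T\<close>.\<close>
    define G where "G i = V.span (T \<union> F i)" for i
    define A where "A = {i \<in> N. V.dim (G i) = V.dim T + 1}"
    have dim_ext: "V.dim (V.span (insert v T)) = V.dim T + 1" if "v \<notin> T" for v
      using that by (simp add: V.dim_insert span_T)
    have T_ext: "T \<subseteq> V.span (insert v T)" for v
      using V.span_superset by blast
    have T_G: "T \<subseteq> G i" for i
      using V.span_superset unfolding G_def by blast
    \<comment> \<open>Exchange: some \<open>f\<close> in \<open>F i\<close> outside \<open>T\<close>
      lies in the span of \<open>T\<close> and \<open>v\<close>, so \<open>v\<close> lies in the
      span of \<open>T\<close> and \<open>f\<close>. Hence \<open>G i\<close> is the span of
      \<open>T\<close> and \<open>v\<close>.\<close>
    have G_ext: "i \<in> A \<and> v \<in> G i" if h: "v \<notin> T" "i \<in> N" "F i \<subseteq> V.span (insert v T)" for v i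
    proof -
      obtain f where f: "f \<in> F i" "f \<notin> T" using h(2) less.prems(2) by blast
      have "v \<in> V.span (insert f T)"
        by (rule V.in_span_insert) (use f h(3) in \<open>auto simp: span_T\<close>)
      moreover have "V.span (insert f T) \<subseteq> G i"
        unfolding G_def by (rule V.span_mono) (use f in blast)
      ultimately have v: "v \<in> G i" by blast
      then have "V.span (insert v T) \<subseteq> G i"
        using T_G by (intro V.span_minimal) (auto simp: G_def)
      moreover have "G i \<subseteq> V.span (insert v T)"
        unfolding G_def using h(3) T_ext by (intro V.span_minimal) auto
      ultimately show ?thesis using v h dim_ext[OF h(1)] by (simp add: A_def)
    qed
    show ?case
    proof (cases "V.dim T + 1 = V.dim UNIV")
      case True
      then have "hyperplane_of scale UNIV T" using T by (simp add: hyperplane_of_def)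
      from scattered[OF this less.prems(2)] show ?thesis using True by simp
    next
      case not_hyperplane: False
      have IH: "R.dim (U \<inter> V.span (insert v T)) \<le> V.dim T + 1"
        if "v \<notin> T" "\<forall>i\<in>N. \<not> F i \<subseteq> V.span (insert v T)" for v
        using less.hyps[of "V.span (insert v T)"] that dim_less dim_ext[OF that(1)] by simp
      show ?thesis
      proof (cases "\<exists>u\<in>U - T. \<forall>i\<in>N. \<not> F i \<subseteq> V.span (insert u T)")
        case True
        then obtain u where u: "u \<in> U" "u \<notin> T" "\<forall>i\<in>N. \<not> F i \<subseteq> V.span (insert u T)" by blast
        have "R.span (U \<inter> T) = U \<inter> T" using subspace_UT by simp
        then have "u \<notin> R.span (U \<inter> T)" using u(2) by blast
        then have "R.dim (insert u (U \<inter> T)) = R.dim (U \<inter> T) + 1" by (simp add: R.dim_insert)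
        moreover have "insert u (U \<inter> T) \<subseteq> U \<inter> V.span (insert u T)"
          using u T_ext V.span_base by blast
        ultimately have "R.dim (U \<inter> T) + 1 \<le> R.dim (U \<inter> V.span (insert u T))"
          using R.dim_subset by metis
        then show ?thesis using IH[OF u(2,3)] by simp
      next
        case False
        have cover: "\<exists>i\<in>A. u \<in> G i" if "u \<in> U" "u \<notin> T" for u
          using False G_ext that by blast
        have "\<not> U \<subseteq> T" using span_U V.span_minimal[OF _ T] \<open>T \<noteq> UNIV\<close> by blast
        then obtain a where a: "a \<in> A" using cover by blast
        have fin_A: "finite A" and card_A: "card A \<le> card N"
          using finite_index by (auto simp: A_def intro: card_mono)
        have subspace_G: "V.subspace (G i)" for i by (simp add: G_def)
        \<comment> \<open>As \<open>T\<close> is neither the whole space nor a hyperplane, its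
          codimension is at least 2. So fewer than \<open>CARD('K)\<close> spaces of dimension one
          more than \<open>T\<close> cannot fill the space.\<close>
        have "card (\<Union>i\<in>A. G i) \<le> (\<Sum>i\<in>A. card (G i))"
          by (rule card_UN_le[OF fin_A])
        also have "\<dots> = card A * CARD('K) ^ (V.dim T + 1)"
          by (simp add: card_V[OF subspace_G] A_def)
        also have "\<dots> < CARD('K) * CARD('K) ^ (V.dim T + 1)"
          using card_A card_N by (intro mult_strict_right_mono) auto
        also have "\<dots> \<le> CARD('K) ^ V.dim UNIV"
          using dim_less not_hyperplane
          by (subst power_Suc[symmetric], intro power_increasing) auto
        also have "\<dots> = CARD('v)" by (simp add: card_V)
        finally have "(\<Union>i\<in>A. G i) \<noteq> UNIV" by (metis less_irrefl)
        then obtain v where v: "v \<notin> (\<Union>i\<in>A. G i)" by blast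
        then have "v \<notin> T" using a T_G by blast
        moreover have "\<forall>i\<in>N. \<not> F i \<subseteq> V.span (insert v T)"
          using v G_ext[OF \<open>v \<notin> T\<close>] by blast
        ultimately have "R.dim (U \<inter> V.span (insert v T)) \<le> V.dim T + 1" by (rule IH)
        moreover have "R.dim (U \<inter> T) \<le> R.dim (U \<inter> V.span (insert v T))"
          using T_ext by (intro R.dim_subset) blast
        \<comment> \<open>The weight of \<open>T\<close> is at most \<open>V.dim T + 1\<close>,
          which is at most \<open>V.dim UNIV - 1\<close>; the rest is
          \<open>dim_U_ge\<close>.\<close>
        ultimately have w: "R.dim (U \<inter> T) + card N + 1 \<le> R.dim U"
          using dim_U_ge dim_less not_hyperplane by simp
        \<comment> \<open>The cover is a set of subspaces, since different indices may give the same
          \<open>G i\<close>.\<close>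
        have "card U \<le> (card (G ` A))\<^sup>2 * card (U \<inter> T)"
        proof (rule card_le_of_cover[OF subspace_U])
          show "R.subspace S" if "S \<in> G ` A" for S
            using that subspace_G subspace_restrict by blast
          \<comment> \<open>The points of \<open>U\<close> inside \<open>T\<close> are covered by
            \<open>G a\<close>.\<close>
          show "U \<subseteq> \<Union> (G ` A)" using cover a T_G by blast
          show "\<not> U \<subseteq> S" if "S \<in> G ` A" for S
          proof
            assume "U \<subseteq> S"
            moreover obtain i where i: "i \<in> A" "S = G i" using \<open>S \<in> G ` A\<close> by blast
            ultimately have "G i = UNIV" using span_U V.span_minimal[OF _ subspace_G] by blast
            then show False using i(1) not_hyperplane by (simp add: A_def)
          qed
          show "S \<inter> S' \<subseteq> T" if "S \<in> G ` A" "S' \<in> G ` A" "S \<noteq> S'" for S S'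
          proof (rule ccontr)
            assume "\<not> S \<inter> S' \<subseteq> T"
            then obtain x where x: "x \<in> S" "x \<in> S'" "x \<notin> T" by blast
            \<comment> \<open>Two members sharing a vector \<open>x\<close> outside \<open>T\<close>
              both equal the span of \<open>T\<close> and \<open>x\<close>, because the dimensions
              agree.\<close>
            have "V.span (insert x T) = G i" if i: "i \<in> A" "x \<in> G i" for i
            proof (rule V.subspace_dim_equal)
              show "V.span (insert x T) \<subseteq> G i"
                using i T_G by (intro V.span_minimal subspace_G) auto
            qed (use i subspace_G dim_ext[OF x(3)] in \<open>auto simp: A_def\<close>)
            then show False using x that by blast
          qed
        qed (use fin_A in simp)
        also have "\<dots> \<le> (card N)\<^sup>2 * card (U \<inter> T)"
          using card_image_le[OF fin_A, of G] card_A by (intro mult_right_mono power_mono) auto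
        also have "\<dots> < CARD('f) ^ (card N + 1) * card (U \<inter> T)"
        proof (rule mult_strict_right_mono)
          have "(card N)\<^sup>2 < 2 ^ (card N + 1)" using square_add_2_le_power[of "card N"] by simp
          also have "\<dots> \<le> CARD('f) ^ (card N + 1)"
            by (rule power_mono) (use card_scalars_ge_2 in auto)
          finally show "(card N)\<^sup>2 < CARD('f) ^ (card N + 1)" .
          show "0 < card (U \<inter> T)"
            using R.subspace_0[OF subspace_U] V.subspace_0[OF T] by (auto simp: card_gt_0_iff)
        qed
        also have "\<dots> = CARD('f) ^ (card N + 1 + R.dim (U \<inter> T))"
          by (simp add: card_R[OF subspace_UT] power_add)
        also have "\<dots> \<le> CARD('f) ^ R.dim U"
          using w by (intro power_increasing) auto
        finally show ?thesis by (simp add: card_R[OF subspace_U])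
      qed
    qed
  qed
  then show ?thesis by (simp add: defect_def weight_def)
qed

section \<open>Scatteredness and minimal subspaces for one decomposition\<close>

lemma minimal_wrt_defect_eq_if_scattered:
  assumes scattered: "\<And>H. hyperplane_of scale UNIV H \<Longrightarrow> \<forall>i\<in>N. \<not> F i \<subseteq> H \<Longrightarrow>
      R.dim (U \<inter> H) \<le> V.dim UNIV - 1"
  shows "{T. V.subspace T \<and> 0 < eps T \<and> minimal_wrt_defect emb scale U T}
    = {FS I |I. I \<noteq> {} \<and> I \<subseteq> N}"
proof -
  define J where "J T = {i \<in> N. F i \<subseteq> T}" for T
  have J: "J T \<subseteq> N" for T by (auto simp: J_def)
  have FS_J: "FS (J T) \<subseteq> T" if "V.subspace T" for T
    by (rule V.sum_of_subspaces_least[OF that]) (auto simp: J_def)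
  \<comment> \<open>The remainder \<open>T \<inter> FS (N - J T)\<close> contains no component:
    those indexed by \<open>J T\<close> are not in \<open>FS (N - J T)\<close>, the others not in
    \<open>T\<close>. So it contributes nothing positive to the defect.\<close>
  have le: "eps T \<le> eps (FS (J T))" if T: "V.subspace T" for T
  proof -
    have "\<not> F i \<subseteq> T \<inter> FS (N - J T)" if i: "i \<in> N" for i
      using F_subset_FS_D[OF i, of "N - J T"] i by (auto simp: J_def)
    then have "eps (T \<inter> FS (N - J T)) \<le> 0"
      using T subspace_FS by (intro defect_nonpos scattered V.subspace_inter) auto
    then show ?thesis using defect_split[OF T J FS_J[OF T]] by simp
  qed
  show ?thesis
  proof (intro equalityI subsetI; clarify)
    fix T assume T: "V.subspace T" "0 < eps T" "minimal_wrt_defect emb scale U T"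
    have "FS (J T) = T"
    proof (rule ccontr)
      assume "FS (J T) \<noteq> T"
      then have "eps (FS (J T)) < eps T"
        using T(3) FS_J[OF T(1)] subspace_FS by (auto simp: minimal_wrt_defect_def)
      then show False using le[OF T(1)] by simp
    qed
    moreover have "J T \<noteq> {}"
      using le[OF T(1)] T(2) defect_FS[of "{}"] by auto
    ultimately show "\<exists>I. T = FS I \<and> I \<noteq> {} \<and> I \<subseteq> N" using J by blast
  next
    fix T I assume I: "I \<noteq> {}" "I \<subseteq> N"
    \<comment> \<open>\<open>J T'\<close> is a proper subset of \<open>I\<close>, as otherwise
      \<open>FS I\<close> would lie in \<open>T'\<close>. Each missing component lowers the defect
      strictly.\<close>
    have "eps T' < eps (FS I)" if T': "V.subspace T'" "T' \<subset> FS I" for T'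
    proof -
      have JI: "J T' \<subseteq> I" using T'(2) F_subset_FS_D[OF _ I(2)] by (auto simp: J_def)
      moreover have "J T' \<noteq> I" using T'(2) FS_J[OF T'(1)] by auto
      ultimately obtain b where b: "b \<in> I - J T'" by blast
      have pos: "0 < int (R.dim (Us i)) - int (V.dim (F i))" if "i \<in> I" for i
        using dim_component[of i] that I(2) by auto
      have "eps (FS (J T')) < eps (FS I)"
        unfolding defect_FS[OF J] defect_FS[OF I(2)]
        by (rule sum_strict_mono2[OF finite_subset[OF I(2) finite_index] JI b])
          (use pos b in \<open>auto intro: less_imp_le\<close>)
      then show ?thesis using le[OF T'(1)] by simp
    qed
    then show "V.subspace (FS I) \<and> 0 < eps (FS I) \<and> minimal_wrt_defect emb scale U (FS I)"
      using subspace_FS defect_FS_pos I by (auto simp: minimal_wrt_defect_def)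
  qed
qed

text \<open>\<open>T\<close> contains a minimal subspace of at least the same defect, which by
  hypothesis is a nonempty sum of components.\<close>

lemma component_of_positive_defect:
  assumes "{T. V.subspace T \<and> 0 < eps T \<and> minimal_wrt_defect emb scale U T}
      = {FS I |I. I \<noteq> {} \<and> I \<subseteq> N}"
    and "V.subspace T" and "0 < eps T"
  shows "\<exists>i\<in>N. F i \<subseteq> T"
proof -
  obtain M where M: "V.subspace M" "M \<subseteq> T" "eps T \<le> eps M" "minimal_wrt_defect emb scale U M"
    using exists_minimal_wrt_defect[OF assms(2)] by blast
  then have "M \<in> {FS I |I. I \<noteq> {} \<and> I \<subseteq> N}" using assms(3) unfolding assms(1)[symmetric] by simp
  then obtain I i where "i \<in> I" "I \<subseteq> N" "M = FS I" by blast
  then show ?thesis using F_subset_FS M(2) by blast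
qed

lemma F_subset_F_D:
  assumes "i \<in> N" "j \<in> N" "F i \<subseteq> F j"
  shows "i = j"
  using F_subset_FS_D[of i "{j}"] assms by (auto simp: sum_of_subspaces_singleton)

text \<open>By contraposition of \<open>component_of_positive_defect\<close>, a subspace containing
  no component has weight at most its dimension. This applies both to hyperplanes of the whole space
  and to hyperplanes of a single \<open>F i\<close>.\<close>

lemma scattered_if_minimal_wrt_defect_eq:
  assumes min: "{T. V.subspace T \<and> 0 < eps T \<and> minimal_wrt_defect emb scale U T}
      = {FS I |I. I \<noteq> {} \<and> I \<subseteq> N}"
  shows "i \<in> N \<Longrightarrow> scattered_wrt_hyperplanes emb scale (F i) (Us i)"
    and "hyperplane_of scale UNIV H \<Longrightarrow> \<forall>i\<in>N. \<not> F i \<subseteq> H \<Longrightarrow>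
      R.dim (U \<inter> H) \<le> V.dim UNIV - 1"
proof -
  have le: "R.dim (U \<inter> T) \<le> V.dim T" if "V.subspace T" "\<forall>i\<in>N. \<not> F i \<subseteq> T" for T
    using component_of_positive_defect[OF min, of T] that
    by (force simp: defect_def weight_def)
  show "R.dim (U \<inter> H) \<le> V.dim UNIV - 1"
    if "hyperplane_of scale UNIV H" "\<forall>i\<in>N. \<not> F i \<subseteq> H" for H
    using le[of H] that by (auto simp: hyperplane_of_def)
  show "scattered_wrt_hyperplanes emb scale (F i) (Us i)" if i: "i \<in> N"
    unfolding scattered_wrt_hyperplanes_def
  proof clarify
    fix H assume H: "hyperplane_of scale (F i) H"
    have "\<not> F j \<subseteq> H" if j: "j \<in> N" for j
    proof
      assume "F j \<subseteq> H"
      moreover from this have "i = j" using H F_subset_F_D[OF j i] by (auto simp: hyperplane_of_def)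
      ultimately show False
        using H V.dim_subset[of "F i" H] by (auto simp: hyperplane_of_def)
    qed
    then have "R.dim (U \<inter> H) \<le> V.dim H" using H le[of H] by (auto simp: hyperplane_of_def)
    moreover have "R.dim (Us i \<inter> H) \<le> R.dim (U \<inter> H)"
      using component_subset[OF i] by (intro R.dim_subset) blast
    ultimately show "R.dim (Us i \<inter> H) \<le> V.dim (F i) - 1"
      using H by (auto simp: hyperplane_of_def)
  qed
qed

section \<open>Comparison of two decompositions of the same subspace\<close>

lemma sums_of_components_unique:
  assumes "decomposed_subspace scale Basis emb N Us' U"
    and dims: "\<And>i. i \<in> N \<Longrightarrow> V.dim (V.span (Us' i)) = V.dim (F i)"
    and min: "{T. V.subspace T \<and> 0 < eps T \<and> minimal_wrt_defect emb scale U T}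
      = {FS I |I. I \<noteq> {} \<and> I \<subseteq> N}"
  shows "{sum_of_subspaces I (\<lambda>i. V.span (Us' i)) |I. I \<noteq> {} \<and> I \<subseteq> N}
    = {FS I |I. I \<noteq> {} \<and> I \<subseteq> N}"
proof -
  interpret D: decomposed_subspace scale Basis emb N Us' U by fact
  \<comment> \<open>The defect depends on \<open>U\<close> alone, so its positivity on
    \<open>D.F i\<close> can be taken from the second decomposition and used in the first.\<close>
  have "\<exists>j\<in>N. F j \<subseteq> D.F i" if "i \<in> N" for i
    using component_of_positive_defect[OF min, of "D.F i"] D.defect_FS_pos[of "{i}"] that
    by (simp add: sum_of_subspaces_singleton)
  then obtain s where s: "\<And>i. i \<in> N \<Longrightarrow> s i \<in> N \<and> F (s i) \<subseteq> D.F i" by metis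
  have inj: "inj_on s N"
  proof (rule inj_onI, rule ccontr)
    fix i j assume ij: "i \<in> N" "j \<in> N" "s i = s j" "i \<noteq> j"
    obtain x where "x \<in> F (s i)" "x \<noteq> 0" using F_nonzero s ij(1) by blast
    moreover have "D.F i \<inter> D.F j \<subseteq> {0}"
      using D.FS_Int_complement[of "{i}"] D.F_subset_FS[of j "N - {i}"] ij
      by (auto simp: sum_of_subspaces_singleton)
    ultimately show False using s ij by (metis IntI singletonD subsetD)
  qed
  then have surj: "s ` N = N" using s finite_index by (intro endo_inj_surj) auto
  have eq: "F (s i) = D.F i" if i: "i \<in> N" for i
  proof (rule V.subspace_dim_equal)
    \<comment> \<open>The inclusions give an inequality for each index. As \<open>s\<close> permutes
      \<open>N\<close>, the two sums agree, so every inequality is an equality.\<close>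
    have "(\<Sum>i\<in>N. V.dim (F (s i))) = (\<Sum>i\<in>N. V.dim (F i))"
      using sum.reindex[OF inj, of "\<lambda>i. V.dim (F i)"] surj by simp
    also have "\<dots> = (\<Sum>i\<in>N. V.dim (D.F i))" using dims by simp
    finally show "V.dim (D.F i) \<le> V.dim (F (s i))"
      using sum_mono_inv[OF _ _ i finite_index] s V.dim_subset by (metis order_refl)
  qed (use s i in auto)
  have "D.FS I = FS (s ` I)" if "I \<subseteq> N" for I
    using that inj_on_subset[OF inj that] eq
    by (subst sum_of_subspaces_reindex) (auto intro!: sum_of_subspaces_cong)
  then have "D.FS ` {I. I \<noteq> {} \<and> I \<subseteq> N} = (\<lambda>I. FS (s ` I)) ` {I. I \<noteq> {} \<and> I \<subseteq> N}"
    by (intro image_cong) auto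
  also have "\<dots> = FS ` (image s ` {I. I \<noteq> {} \<and> I \<subseteq> N})" by (simp add: image_image)
  also have "image s ` {I. I \<noteq> {} \<and> I \<subseteq> N} = {I. I \<noteq> {} \<and> I \<subseteq> N}"
  proof -
    have "I \<in> image s ` {I. I \<noteq> {} \<and> I \<subseteq> N}" if "I \<noteq> {}" "I \<subseteq> N" for I
      using that surj subset_image_iff[of I s N] by auto
    then show ?thesis using s by auto
  qed
  finally show ?thesis by (simp add: setcompr_eq_image)
qed

end

theorem theorem1p18:
  fixes emb :: "'f::{field,finite} \<Rightarrow> 'K::{field,finite}"
    and scale :: "'K \<Rightarrow> 'v::ab_group_add \<Rightarrow> 'v"
    and B U :: "'v set"
    and Us F :: "nat \<Rightarrow> 'v set"
    and ks ns :: "nat \<Rightarrow> nat"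
    and q m k n t :: nat
  assumes "CARD('f) = q" and "CARD('K) = q ^ m" and "0 < m"
    and "field_embedding emb"
    and "finite_dimensional_vector_space scale B"
    and "vector_space.dim scale (UNIV :: 'v set) = k"
    and "k = (\<Sum>i\<in>{1..t}. ks i)" and "n = (\<Sum>i\<in>{1..t}. ns i)"
    and "\<And>i. i \<in> {1..t} \<Longrightarrow> ks i < ns i"
    and "module.subspace (restrict_scale emb scale) U"
    and "vector_space.dim (restrict_scale emb scale) U = n"
    and "decomposition emb scale t ks ns U Us"
    and "\<And>i. i \<in> {1..t} \<Longrightarrow> F i = module.span scale (Us i)"
  shows "k_scattered emb scale t ks ns U \<longleftrightarrow>
    {T. module.subspace scale T \<and> defect emb scale U T > 0 \<and> minimal_wrt_defect emb scale U T}
      = {sum_of_subspaces I F | I. I \<noteq> {} \<and> I \<subseteq> {1..t}}"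
proof -
  interpret scalar_restriction scale B emb
    using assms(4,5) by (simp add: scalar_restriction_def scalar_restriction_axioms_def)
  have decomposed: "decomposed_subspace scale B emb {1..t} Ws U"
    if "decomposition emb scale t ks ns U Ws" for Ws
    using that assms(9) scalar_restriction_axioms
    by (simp add: decomposition_def decomposed_subspace_def decomposed_subspace_axioms_def)
  interpret D: decomposed_subspace scale B emb "{1..t}" Us U
    by (rule decomposed) fact
  have "sum_of_subspaces I F = D.FS I" if "I \<subseteq> {1..t}" for I
    using that assms(13) by (intro sum_of_subspaces_cong) auto
  then have sums_F: "{sum_of_subspaces I F | I. I \<noteq> {} \<and> I \<subseteq> {1..t}}
      = {D.FS I | I. I \<noteq> {} \<and> I \<subseteq> {1..t}}"
    by (simp add: setcompr_eq_image cong: image_cong_simp)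
  show ?thesis
    unfolding sums_F
  proof
    assume "k_scattered emb scale t ks ns U"
    then obtain Ws where Ws: "decomposition emb scale t ks ns U Ws"
      and scattered: "\<forall>H. hyperplane_of scale UNIV H \<and> (\<forall>i\<in>{1..t}. \<not> V.span (Ws i) \<subseteq> H)
        \<longrightarrow> R.dim (U \<inter> H) \<le> V.dim UNIV - 1"
      by (auto simp: k_scattered_def)
    \<comment> \<open>\<open>E\<close> is the decomposition witnessing scatteredness,
      \<open>D\<close> the given one. The minimal subspaces are found for \<open>E\<close> and then
      rewritten in terms of \<open>D\<close>.\<close>
    interpret E: decomposed_subspace scale B emb "{1..t}" Ws U
      by (rule decomposed) fact
    have min: "{T. V.subspace T \<and> 0 < E.eps T \<and> minimal_wrt_defect emb scale U T}
        = {E.FS I |I. I \<noteq> {} \<and> I \<subseteq> {1..t}}"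
      by (rule E.minimal_wrt_defect_eq_if_scattered) (use scattered in blast)
    have "V.dim (D.F i) = V.dim (E.F i)" if "i \<in> {1..t}" for i
      using that Ws assms(12) by (simp add: decomposition_def)
    from E.sums_of_components_unique[OF D.decomposed_subspace_axioms this min]
    show "{T. V.subspace T \<and> 0 < D.eps T \<and> minimal_wrt_defect emb scale U T}
        = {D.FS I |I. I \<noteq> {} \<and> I \<subseteq> {1..t}}"
      using min by simp
  next
    assume min: "{T. V.subspace T \<and> 0 < D.eps T \<and> minimal_wrt_defect emb scale U T}
        = {D.FS I |I. I \<noteq> {} \<and> I \<subseteq> {1..t}}"
    \<comment> \<open>The given components serve as the witness.\<close>
    show "k_scattered emb scale t ks ns U"
      unfolding k_scattered_def
      using assms(9,12) D.scattered_if_minimal_wrt_defect_eq[OF min] by blast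
  qed
qed

end
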